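(* Let $X=\{(a,b)\in\mathbb{R}^2: b>0\}\cup\{(0,0),(1,0)\}$ with the Euclidean metric. Then in the race to a point game on $X$ in which both players start at $(1,0)$ and the target is $(0,0)$, both players have a winning strategy.
   Context: Race to a point game on a metric space $X$ with given starting points for Player A and Player B and a target $y$. A path of a player is a function $p:[0,\infty)\to X$ with $d(p(s),p(t))\le|s-t|$ for all $s,t$ and with $p(0)$ equal to that player's starting point. Given paths of the two players, the player whose path first reaches the target strictly before the other's does (in particular if the other's never reaches it) wins; the game is a draw if both reach the target for the first time at the same time or if neither ever reaches it. A strategy for a player is a function $G$ from the set of the opponent's paths to the set of the player's own paths satisfying the no-lookahead rule: if opponent paths $p,p'$ agree on $[0,t]$ then $G(p)$ and $G(p')$ agree on $[0,t]$. A strategy $G$ is winning if for every opponent path $p$, when the opponent follows $p$ and the player follows $G(p)$, the player wins. *)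

theory Defs
  imports "HOL-Analysis.Analysis"
begin

text \<open>
  The metric space is a subset \<open>X\<close> of a type of class \<^class>\<open>metric_space\<close>, with the restricted
  metric. Paths are extensional, so that they are exactly the functions from \<open>[0, \<infinity>)\<close> to \<open>X\<close>.
\<close>

definition race_paths :: "'a::metric_space set \<Rightarrow> 'a \<Rightarrow> (real \<Rightarrow> 'a) set" where
  "race_paths X x0 =
     {p \<in> {0..} \<rightarrow>\<^sub>E X. (\<forall>s\<ge>0. \<forall>t\<ge>0. dist (p s) (p t) \<le> \<bar>s - t\<bar>) \<and> p 0 = x0}"

text \<open>
  The value is \<open>\<infinity>\<close> if the target is never reached; otherwise, paths being continuous,
  the infimum is attained.
\<close>

definition reach_time :: "'a \<Rightarrow> (real \<Rightarrow> 'a) \<Rightarrow> ereal" where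
  "reach_time y p = Inf (ereal ` {t. 0 \<le> t \<and> p t = y})"

definition wins_race :: "'a \<Rightarrow> (real \<Rightarrow> 'a) \<Rightarrow> (real \<Rightarrow> 'a) \<Rightarrow> bool" where
  "wins_race y own opp \<longleftrightarrow> reach_time y own < reach_time y opp"

text \<open>
  In the next two definitions, the player's own starting point precedes the opponent's.
  Values of \<open>G\<close> outside the set of the opponent's paths are irrelevant.
\<close>

definition race_strategy ::
  "'a::metric_space set \<Rightarrow> 'a \<Rightarrow> 'a \<Rightarrow> ((real \<Rightarrow> 'a) \<Rightarrow> (real \<Rightarrow> 'a)) \<Rightarrow> bool" where
  "race_strategy X own opp G \<longleftrightarrow>
     G \<in> race_paths X opp \<rightarrow> race_paths X own \<and>
     (\<forall>p\<in>race_paths X opp. \<forall>p'\<in>race_paths X opp. \<forall>t\<ge>0.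
        (\<forall>s\<in>{0..t}. p s = p' s) \<longrightarrow> (\<forall>s\<in>{0..t}. G p s = G p' s))"

definition winning_race_strategy ::
  "'a::metric_space set \<Rightarrow> 'a \<Rightarrow> 'a \<Rightarrow> 'a \<Rightarrow> ((real \<Rightarrow> 'a) \<Rightarrow> (real \<Rightarrow> 'a)) \<Rightarrow> bool" where
  "winning_race_strategy X own opp y G \<longleftrightarrow>
     race_strategy X own opp G \<and> (\<forall>p\<in>race_paths X opp. wins_race y (G p) p)"

text \<open>In the game on \<open>X\<close>, Player A starts at \<open>a\<close>, Player B starts at \<open>b\<close>, and the target is \<open>y\<close>.\<close>

definition player_A_has_winning_strategy ::
  "'a::metric_space set \<Rightarrow> 'a \<Rightarrow> 'a \<Rightarrow> 'a \<Rightarrow> bool" where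
  "player_A_has_winning_strategy X a b y \<longleftrightarrow> (\<exists>G. winning_race_strategy X a b y G)"

definition player_B_has_winning_strategy ::
  "'a::metric_space set \<Rightarrow> 'a \<Rightarrow> 'a \<Rightarrow> 'a \<Rightarrow> bool" where
  "player_B_has_winning_strategy X a b y \<longleftrightarrow> (\<exists>G. winning_race_strategy X b a y G)"

end

theory Submission imports Defs begin

text \<open>
  The players are in the same position, so a single strategy serves both. The origin is at distance
  \<open>1\<close> from the start, but the segment joining them lies outside \<open>X\<close> except for its endpoints.
  Hence no path is optimal, and at every time \<open>t > 0\<close> an opponent with path \<open>p\<close> has already wasted
  an amount \<open>slack p t = t + \<parallel>p t\<parallel> - 1 > 0\<close> of time. The slack never decreases, and an opponent who
  arrives at time \<open>T\<close> has \<open>slack p T = T - 1\<close>; so the slack observed at time \<open>t\<close> is a certified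
  lower bound for the delay of the opponent's arrival beyond time \<open>1\<close>.

  The strategy wastes at most half of what the opponent has already wasted. It keeps at distance
  about \<open>1 - t + g t\<close> from the target, where \<open>g\<close> is half of the slack, and spends the waste \<open>g t\<close>
  on turning away from the horizontal axis by an amount proportional to \<open>g t\<close>. As \<open>g t > 0\<close> for
  \<open>t > 0\<close>, the player leaves the axis immediately and stays in \<open>X\<close>; as the sum of the radial and
  the angular speed is at most \<open>(1 - g') + g' = 1\<close>, the speed limit is respected. Capping \<open>g\<close> at
  \<open>1/2\<close> makes the player arrive even if the opponent never does. Only the current position of the
  opponent is used, so there is no lookahead. This is carried by \<open>slack_pos\<close>,
  \<open>spiral_in_race_paths\<close> and \<open>spiral_wins\<close>.
\<close>

definition slack :: "(real \<Rightarrow> 'a::real_normed_vector) \<Rightarrow> real \<Rightarrow> real" where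
  "slack p t = t + norm (p t) - 1"

definition allowance :: "(real \<Rightarrow> 'a::real_normed_vector) \<Rightarrow> real \<Rightarrow> real" where
  "allowance p t = min (slack p t / 2) (1 / 2)"

text \<open>
  A curve in polar form, with radius \<open>1 - t + g\<close>. The direction \<open>(1 - g/2, g/2)\<close> replaces
  \<open>(cos g, sin g)\<close>: all that matters is that it stays in the unit ball, moves no faster than \<open>g\<close>,
  starts at \<open>(1, 0)\<close> and lies above the axis when \<open>g > 0\<close>.
\<close>

definition spiral :: "(real \<Rightarrow> real) \<Rightarrow> real \<Rightarrow> real \<times> real" where
  "spiral g = (\<lambda>t\<in>{0..}. max 0 (1 - t + g t) *\<^sub>R (1 - g t / 2, g t / 2))"

lemma race_paths_dist:
  assumes "p \<in> race_paths X x0" "0 \<le> s" "0 \<le> t"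
  shows "dist (p s) (p t) \<le> \<bar>s - t\<bar>"
  using assms by (simp add: race_paths_def)

lemma slack_increment:
  assumes "p \<in> race_paths X x0" "0 \<le> s" "s \<le> t"
  shows "slack p s \<le> slack p t" and "slack p t - slack p s \<le> 2 * (t - s)"
proof -
  have "\<bar>norm (p t) - norm (p s)\<bar> \<le> t - s"
    using race_paths_dist[OF assms(1), of t s] norm_triangle_ineq3[of "p t" "p s"] assms(2,3)
    by (simp add: dist_norm)
  then show "slack p s \<le> slack p t" "slack p t - slack p s \<le> 2 * (t - s)"
    by (simp_all add: slack_def abs_le_iff)
qed

lemma allowance_increment:
  assumes "p \<in> race_paths X x0" "0 \<le> s" "s \<le> t"
  shows "allowance p s \<le> allowance p t" and "allowance p t - allowance p s \<le> t - s"
  using slack_increment[OF assms] assms(3) by (auto simp: allowance_def min_def)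

text \<open>
  At an early time \<open>s\<close> the path is still far from the origin. Being within \<open>s\<close> of the start, its
  abscissa is at least \<open>1 - s\<close>, and its positive height makes the norm strictly larger than that;
  if it has not left the start, it has wasted the whole time \<open>s\<close>. Later, monotonicity takes over.
\<close>

lemma slack_pos:
  fixes p :: "real \<Rightarrow> real \<times> real"
  assumes p: "p \<in> race_paths ({(a, b). b > 0} \<union> {(0, 0), (1, 0)}) (1, 0)"
    and t: "0 < t"
  shows "0 < slack p t"
proof -
  define s where "s = min t (1 / 2)"
  have s: "0 < s" "s \<le> t" "s \<le> 1 / 2"
    using t by (auto simp: s_def)
  obtain a b where ab: "p s = (a, b)"
    by fastforce
  have "p 0 = (1, 0)" and ps: "p s \<in> {(a, b). b > 0} \<union> {(0, 0), (1, 0)}"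
    using p s by (auto simp: race_paths_def PiE_def Pi_def)
  then have d: "dist (1::real, 0::real) (a, b) \<le> s"
    using race_paths_dist[OF p, of 0 s] s ab by simp
  have "\<bar>1 - a\<bar> \<le> s"
    using d dist_fst_le[of "(1::real, 0::real)" "(a, b)"] by (simp add: dist_real_def)
  then have a: "1 - s \<le> a"
    by simp
  have "1 - s < norm (p s)"
  proof (cases "b > 0")
    case True
    have "a < sqrt (a\<^sup>2 + b\<^sup>2)"
      using True by (intro real_less_rsqrt) auto
    then show ?thesis
      using a ab by (simp add: norm_Pair)
  next
    case False
    then have "a = 1"
      using ps ab a s by auto
    then show ?thesis
      using s norm_fst_le[of "a" b] ab by auto
  qed
  then have "0 < slack p s"
    by (simp add: slack_def)
  also have "\<dots> \<le> slack p t"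
    using slack_increment(1)[OF p, of s t] s by simp
  finally show ?thesis .
qed

text \<open>
  The distance covered between times \<open>s < t\<close> is split into a change of radius, of size at most
  \<open>(t - s) - (g t - g s)\<close>, and a change of direction, of size at most \<open>g t - g s\<close> because the
  radius never exceeds \<open>1\<close>.
\<close>

lemma spiral_in_race_paths:
  assumes g0: "g 0 = 0"
    and pos: "\<And>t. 0 < t \<Longrightarrow> 0 < g t"
    and le: "\<And>t. g t \<le> 2"
    and mono: "\<And>s t. 0 \<le> s \<Longrightarrow> s \<le> t \<Longrightarrow> g s \<le> g t"
    and lip: "\<And>s t. 0 \<le> s \<Longrightarrow> s \<le> t \<Longrightarrow> g t - g s \<le> t - s"
  shows "spiral g \<in> race_paths ({(a, b). b > 0} \<union> {(0, 0), (1, 0)}) (1, 0)"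
proof -
  define r where "r t = max 0 (1 - t + g t)" for t
  define u where "u t = (1 - g t / 2, g t / 2)" for t
  have spiral: "spiral g t = r t *\<^sub>R u t" if "0 \<le> t" for t
    using that by (simp add: spiral_def r_def u_def)
  have g_nonneg: "0 \<le> g t" if "0 \<le> t" for t
    using g0 mono[of 0 t] that by simp
  have norm_u: "norm (u t) \<le> 1" if "0 \<le> t" for t
    using norm_Pair_le[of "1 - g t / 2" "g t / 2"] g_nonneg[OF that] le[of t] by (simp add: u_def)
  have r_le: "0 \<le> r t" "r t \<le> 1" if "0 \<le> t" for t
    using lip[of 0 t] g0 that by (auto simp: r_def)
  have step: "dist (spiral g s) (spiral g t) \<le> t - s" if st: "0 \<le> s" "s \<le> t" for s t
  proof -
    have t: "0 \<le> t"
      using st by simp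
    have "spiral g s - spiral g t = (r s - r t) *\<^sub>R u t + r s *\<^sub>R (u s - u t)"
      using st t by (simp add: spiral algebra_simps)
    then have "dist (spiral g s) (spiral g t) \<le> \<bar>r s - r t\<bar> * norm (u t) + r s * norm (u s - u t)"
      using norm_triangle_ineq[of "(r s - r t) *\<^sub>R u t" "r s *\<^sub>R (u s - u t)"] r_le(1)[OF st(1)]
      by (simp add: dist_norm)
    also have "\<dots> \<le> \<bar>r s - r t\<bar> * 1 + 1 * norm (u s - u t)"
      using norm_u[OF t] r_le[OF st(1)] by (intro add_mono mult_mono) auto
    also have "norm (u s - u t) \<le> g t - g s"
      using norm_Pair_le[of "g t / 2 - g s / 2" "g s / 2 - g t / 2"] mono[OF st]
      by (simp add: u_def)
    also have "\<bar>r s - r t\<bar> \<le> (t - s) - (g t - g s)"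
      using lip[OF st] by (auto simp: r_def)
    finally show ?thesis
      by simp
  qed
  have lipschitz: "dist (spiral g s) (spiral g t) \<le> \<bar>s - t\<bar>" if "0 \<le> s" "0 \<le> t" for s t
    using step[of s t] step[of t s] that by (cases "s \<le> t") (auto simp: dist_commute)
  have start: "spiral g 0 = (1, 0)"
    using g0 by (simp add: spiral r_def u_def)
  have inX: "spiral g t \<in> {(a, b). b > 0} \<union> {(0, 0), (1, 0)}" if t: "0 \<le> t" for t
  proof (cases "t = 0 \<or> r t = 0")
    case True
    then show ?thesis
      using start t by (auto simp: spiral zero_prod_def)
  next
    case False
    then have "0 < r t * (g t / 2)"
      using r_le(1)[OF t] pos[of t] t by simp
    then show ?thesis
      using t by (simp add: spiral u_def)
  qed
  show ?thesis
    using lipschitz start inX by (auto simp: race_paths_def PiE_iff spiral_def extensional_def)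
qed

lemma reach_time_le:
  assumes "0 \<le> t" "p t = y"
  shows "reach_time y p \<le> ereal t"
  unfolding reach_time_def using assms by (intro Inf_lower) auto

text \<open>
  The player reaches the origin by time \<open>1 + c\<close> as soon as \<open>g (1 + c) \<le> c\<close>. If the opponent
  arrives at time \<open>T\<close>, this applies to \<open>c = (T - 1) / 2\<close>, which is half of the slack at time \<open>T\<close>.
  The resulting margin \<open>(T - 1) / 2\<close> is at least half of the slack at time \<open>1\<close>, a positive bound
  independent of \<open>T\<close>, so strictness survives the passage to the infimum over all arrival times.
\<close>

lemma spiral_wins:
  assumes p: "p \<in> race_paths ({(a, b). b > 0} \<union> {(0, 0), (1, 0)}) (1, 0)"
  shows "wins_race (0, 0) (spiral (allowance p)) p"
proof -
  let ?R = "reach_time (0, 0) (spiral (allowance p))"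
  have reached: "?R \<le> ereal (1 + c)" if "allowance p (1 + c) \<le> c" "0 \<le> c" for c
    using that by (intro reach_time_le) (auto simp: spiral_def zero_prod_def)
  define e where "e = slack p 1 / 2"
  have e: "0 < e"
    using slack_pos[OF p, of 1] by (simp add: e_def)
  have margin: "?R + ereal e \<le> ereal T" if T: "0 \<le> T" "p T = (0, 0)" for T
  proof -
    have slack_T: "slack p T = T - 1"
      using T by (simp add: slack_def flip: zero_prod_def)
    have "p 0 = (1, 0)"
      using p by (simp add: race_paths_def)
    then have "0 \<le> slack p T"
      using slack_increment(1)[OF p, of 0 T] T by (simp add: slack_def)
    then have T1: "1 \<le> T"
      using slack_T by simp
    have "slack p (1 + (T - 1) / 2) \<le> slack p T"
      using T1 by (intro slack_increment(1)[OF p]) (auto simp: field_simps)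
    then have "?R \<le> ereal (1 + (T - 1) / 2)"
      using slack_T T1 by (intro reached) (auto simp: allowance_def)
    moreover have "slack p 1 \<le> T - 1"
      using slack_increment(1)[OF p, of 1 T] T1 slack_T by simp
    then have "ereal (1 + (T - 1) / 2) + ereal e \<le> ereal T"
      by (simp add: e_def field_simps)
    ultimately show ?thesis
      by (meson add_right_mono order_trans)
  qed
  have "?R \<le> ereal (1 + 1 / 2)"
    by (intro reached) (auto simp: allowance_def)
  moreover have "0 \<le> ?R"
    unfolding reach_time_def by (auto intro: Inf_greatest)
  ultimately have "?R < ?R + ereal e"
    using e by (cases ?R) auto
  also have "\<dots> \<le> reach_time (0, 0) p"
    unfolding reach_time_def[of _ p] using margin by (auto intro!: Inf_greatest)
  finally show ?thesis
    by (simp add: wins_race_def)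
qed

lemma spiral_winning_strategy:
  "winning_race_strategy ({(a, b). b > 0} \<union> {(0, 0), (1, 0)}) (1, 0) (1, 0) (0, 0)
     (\<lambda>p. spiral (allowance p))"
  (is "winning_race_strategy ?X _ _ _ _")
proof -
  have "spiral (allowance p) \<in> race_paths ?X (1, 0)" if p: "p \<in> race_paths ?X (1, 0)" for p
  proof (rule spiral_in_race_paths)
    show "allowance p 0 = 0"
      using p by (simp add: race_paths_def allowance_def slack_def)
    show "0 < allowance p t" if "0 < t" for t
      using slack_pos[OF p that] by (simp add: allowance_def)
    show "allowance p t \<le> 2" for t
      by (simp add: allowance_def)
  qed (use allowance_increment[OF p] in auto)
  moreover have "spiral (allowance p) s = spiral (allowance p') s"
    if "p s = p' s" for p p' :: "real \<Rightarrow> real \<times> real" and s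
    using that by (simp add: spiral_def allowance_def slack_def restrict_def)
  ultimately show ?thesis
    unfolding winning_race_strategy_def race_strategy_def
    using spiral_wins by blast
qed

theorem proposition11:
  fixes X :: "(real \<times> real) set"
  assumes "X = {(a, b). b > 0} \<union> {(0, 0), (1, 0)}"
  shows "player_A_has_winning_strategy X (1, 0) (1, 0) (0, 0) \<and>
         player_B_has_winning_strategy X (1, 0) (1, 0) (0, 0)"
  using spiral_winning_strategy assms
  unfolding player_A_has_winning_strategy_def player_B_has_winning_strategy_def by blast

end
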